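(* Let $\mathbb{K}$ be an algebraically closed field, let $R$ be a field that is an associative commutative $\mathbb{K}$-algebra, and let $L$ be a finite dimensional Lie algebra over $\mathbb{K}$. Assume that there exists an injective homomorphism of Lie algebras $\varphi: L \rightarrow \mathrm{Der}_{\mathbb{K}} R$, and let $k=\dim_R R \varphi(L)$. Then: (i) $L$ has a subalgebra of codimension $k$; (ii) there exists an irreducible subvariety $V$ of $M_k(L)$ such that $V \nsubseteq M^0_k(L)$ and the intersection of all subalgebras associated to points of $V$ is $\{0\}$.
   Context: $\mathrm{Der}_{\mathbb{K}}R$ is the Lie algebra over $\mathbb{K}$ of $\mathbb{K}$-derivations of $R$; it is also an $R$-vector space, and $R\varphi(L)$ denotes the $R$-linear span of $\varphi(L)$ in it. Let $m=\dim_{\mathbb{K}} L$ and fix a basis $l_1,\dots,l_m$ of $L$. Define the affine algebraic variety $$M_k(L)=\Big\{(a_{ij})_{1\le i\le m-k,\ 1\le j\le m}\in \mathbb{K}^{(m-k)\times m} \ :\ \sum_{i=1}^{m-k}\mathbb{K}\sum_{j=1}^m a_{ij} l_j \text{ is a subalgebra of } L\Big\},$$ and let $M_k^0(L)\subset M_k(L)$ be the closed subset of those $(a_{ij})\in M_k(L)$ for which the elements $\sum_{j=1}^m a_{ij}l_j$, $i=1,\dots,m-k$, are linearly dependent. The subalgebra associated to a point $(a_{ij})\in M_k(L)$ is $\sum_{i=1}^{m-k}\mathbb{K}\sum_{j=1}^m a_{ij} l_j\subset L$; it has codimension $k$ in $L$ if and only if $(a_{ij})\notin M_k^0(L)$.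 *)

theory Defs
  imports
    "HOL-Computational_Algebra.Polynomial"
    "HOL-Library.Function_Algebras"
    "Jordan_Normal_Form.Matrix"
begin

locale lie_algebra = vector_space scale
  for scale :: "'k::field \<Rightarrow> 'l::ab_group_add \<Rightarrow> 'l" +
  fixes bracket :: "'l \<Rightarrow> 'l \<Rightarrow> 'l"
  assumes bracket_add_left: "bracket (x + y) z = bracket x z + bracket y z"
    and bracket_add_right: "bracket x (y + z) = bracket x y + bracket x z"
    and bracket_scale_left: "bracket (scale c x) y = scale c (bracket x y)"
    and bracket_scale_right: "bracket x (scale c y) = scale c (bracket x y)"
    and bracket_self: "bracket x x = 0"
    and jacobi: "bracket x (bracket y z) + bracket y (bracket z x) + bracket z (bracket x y) = 0"
begin

definition subalgebra :: "'l set \<Rightarrow> bool" where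
  "subalgebra S \<longleftrightarrow> subspace S \<and> (\<forall>x\<in>S. \<forall>y\<in>S. bracket x y \<in> S)"

definition ordered_basis :: "'l list \<Rightarrow> bool" where
  "ordered_basis ls \<longleftrightarrow> distinct ls \<and> independent (set ls) \<and> span (set ls) = UNIV"

definition row_element :: "'l list \<Rightarrow> 'k mat \<Rightarrow> nat \<Rightarrow> 'l" where
  "row_element ls A i = (\<Sum>j<length ls. scale (A $$ (i, j)) (ls ! j))"

definition associated_subspace :: "'l list \<Rightarrow> 'k mat \<Rightarrow> 'l set" where
  "associated_subspace ls A = span (row_element ls A ` {..<dim_row A})"

definition subalgebra_variety :: "'l list \<Rightarrow> nat \<Rightarrow> 'k mat set" where
  "subalgebra_variety ls k =
     {A \<in> carrier_mat (length ls - k) (length ls). subalgebra (associated_subspace ls A)}"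

text \<open>Linear dependence is that of the indexed family: a repeated element makes it dependent.\<close>

definition degenerate_locus :: "'l list \<Rightarrow> nat \<Rightarrow> 'k mat set" where
  "degenerate_locus ls k =
     {A \<in> subalgebra_variety ls k. \<exists>c :: nat \<Rightarrow> 'k.
        (\<exists>i<length ls - k. c i \<noteq> 0) \<and> (\<Sum>i<length ls - k. scale (c i) (row_element ls A i)) = 0}"

end

locale finite_dimensional_lie_algebra = lie_algebra +
  assumes finite_dimensional: "\<exists>B. finite B \<and> span B = UNIV"

locale field_algebra = vector_space scale
  for scale :: "'k::field \<Rightarrow> 'r::field \<Rightarrow> 'r" +
  assumes scale_mult_left: "scale c x * y = scale c (x * y)"
begin

definition derivations :: "('r \<Rightarrow> 'r) set" where
  "derivations = {D. Vector_Spaces.linear scale scale D \<and> (\<forall>x y. D (x * y) = D x * y + x * D y)}"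

end

definition commutator :: "('r \<Rightarrow> 'r::ab_group_add) \<Rightarrow> ('r \<Rightarrow> 'r) \<Rightarrow> 'r \<Rightarrow> 'r" where
  "commutator D E = (\<lambda>x. D (E x) - E (D x))"

definition lie_hom_to_derivations ::
  "('k::field \<Rightarrow> 'l::ab_group_add \<Rightarrow> 'l) \<Rightarrow> ('l \<Rightarrow> 'l \<Rightarrow> 'l) \<Rightarrow>
   ('k \<Rightarrow> 'r::field \<Rightarrow> 'r) \<Rightarrow> ('l \<Rightarrow> 'r \<Rightarrow> 'r) \<Rightarrow> bool" where
  "lie_hom_to_derivations scale_L bracket scale_R \<phi> \<longleftrightarrow>
     range \<phi> \<subseteq> field_algebra.derivations scale_R \<and>
     Vector_Spaces.linear scale_L (\<lambda>c D x. scale_R c (D x)) \<phi> \<and>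
     (\<forall>x y. \<phi> (bracket x y) = commutator (\<phi> x) (\<phi> y))"

text \<open>The \<open>R\<close>-vector space structure on \<open>Der R\<close> is the restriction of the pointwise one on all
  maps \<open>R \<Rightarrow> R\<close>, so spans and dimensions can be taken in the latter.\<close>

definition fun_scale :: "'r::field \<Rightarrow> ('r \<Rightarrow> 'r) \<Rightarrow> 'r \<Rightarrow> 'r" where
  "fun_scale r D = (\<lambda>x. r * D x)"

lemma vector_space_fun_scale: "vector_space fun_scale"
  by unfold_locales (auto simp: fun_scale_def fun_eq_iff algebra_simps)

lemma (in field_algebra) subspace_derivations: "module.subspace fun_scale derivations"
proof -
  interpret F: vector_space fun_scale by (rule vector_space_fun_scale)
  have right: "x * scale c y = scale c (x * y)" for c x y
    by (metis mult.commute scale_mult_left)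
  have lin: "Vector_Spaces.linear scale scale D \<longleftrightarrow>
      (\<forall>x y. D (x + y) = D x + D y) \<and> (\<forall>c x. D (scale c x) = scale c (D x))" for D
    using vector_space_axioms by (auto simp: Vector_Spaces.linear_iff)
  show ?thesis
    unfolding F.subspace_def derivations_def lin
    by (auto simp: fun_scale_def algebra_simps right scale_right_distrib)
qed

text \<open>Polynomial functions of the \<open>n m\<close> entries of an \<open>n \<times> m\<close> matrix.\<close>

inductive_set polynomial_functions :: "nat \<Rightarrow> nat \<Rightarrow> ('k::comm_ring_1 mat \<Rightarrow> 'k) set"
  for n m :: nat where
  const: "(\<lambda>A. c) \<in> polynomial_functions n m"
| entry: "i < n \<Longrightarrow> j < m \<Longrightarrow> (\<lambda>A. A $$ (i, j)) \<in> polynomial_functions n m"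
| add: "p \<in> polynomial_functions n m \<Longrightarrow> q \<in> polynomial_functions n m \<Longrightarrow>
    (\<lambda>A. p A + q A) \<in> polynomial_functions n m"
| mult: "p \<in> polynomial_functions n m \<Longrightarrow> q \<in> polynomial_functions n m \<Longrightarrow>
    (\<lambda>A. p A * q A) \<in> polynomial_functions n m"

definition zariski_closed :: "nat \<Rightarrow> nat \<Rightarrow> 'k::comm_ring_1 mat set \<Rightarrow> bool" where
  "zariski_closed n m Z \<longleftrightarrow>
     (\<exists>P \<subseteq> polynomial_functions n m. Z = {A \<in> carrier_mat n m. \<forall>p\<in>P. p A = 0})"

definition irreducible_variety :: "nat \<Rightarrow> nat \<Rightarrow> 'k::comm_ring_1 mat set \<Rightarrow> bool" where
  "irreducible_variety n m V \<longleftrightarrow>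
     zariski_closed n m V \<and> V \<noteq> {} \<and>
     (\<forall>V1 V2. zariski_closed n m V1 \<and> zariski_closed n m V2 \<and> V = V1 \<union> V2 \<longrightarrow>
        V = V1 \<or> V = V2)"

end

theory Submission
  imports Defs
begin

text \<open>The \<open>R\<close>-linear relations among the \<open>\<phi> l\<^sub>j\<close> form a Lie subalgebra \<open>N\<close> of \<open>R \<otimes> L\<close> of
  codimension \<open>k\<close> with \<open>N \<inter> L = 0\<close>. The reduced echelon basis of \<open>N\<close> is a point of \<open>M\<^sub>k(L)\<close> with
  coordinates in \<open>R\<close>, and \<open>V\<close> is the closure of this point, that is, the set of matrices over \<open>K\<close>
  annihilated by every polynomial over \<open>K\<close> that vanishes at it. The echelon shape is inherited by all
  points of \<open>V\<close>. It keeps their rows independent and turns membership in the associated subspace, and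
  hence closure under the bracket, into polynomial equations. By the Nullstellensatz a polynomial
  vanishing on \<open>V\<close> vanishes at the generic point. So \<open>V\<close> is irreducible, and an element of \<open>L\<close> lying in
  all associated subalgebras lies in \<open>N\<close>, hence is \<open>0\<close>.\<close>

section \<open>Homomorphisms from finitely generated subrings of a field\<close>

text \<open>Subrings are sets inside one fixed field, so that generators can be added one at a time
  without changing the type.\<close>

definition unital_subring :: "'a::comm_ring_1 set \<Rightarrow> bool" where
  "unital_subring A \<longleftrightarrow> 1 \<in> A \<and> (\<forall>x\<in>A. \<forall>y\<in>A. x - y \<in> A \<and> x * y \<in> A)"

text \<open>The function is total, but its values outside \<open>A\<close> are
  unconstrained.\<close>

definition hom_on :: "'a::comm_ring_1 set \<Rightarrow> ('a \<Rightarrow> 'b::comm_ring_1) \<Rightarrow> bool" where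
  "hom_on A h \<longleftrightarrow> h 1 = 1 \<and> (\<forall>x\<in>A. \<forall>y\<in>A. h (x + y) = h x + h y \<and> h (x * y) = h x * h y)"

definition polys_over :: "'a::comm_ring_1 set \<Rightarrow> 'a poly set" where
  "polys_over A = {P. \<forall>i. coeff P i \<in> A}"

text \<open>This is the ring \<open>A[x]\<close>.\<close>

definition adjoin :: "'a::comm_ring_1 set \<Rightarrow> 'a \<Rightarrow> 'a set" where
  "adjoin A x = (\<lambda>P. poly P x) ` polys_over A"

section \<open>Closure properties of subrings and of the polynomials over them\<close>

lemma
  assumes "unital_subring A"
  shows unital_subring_one: "1 \<in> A"
    and unital_subring_diff: "x \<in> A \<Longrightarrow> y \<in> A \<Longrightarrow> x - y \<in> A"
    and unital_subring_mult: "x \<in> A \<Longrightarrow> y \<in> A \<Longrightarrow> x * y \<in> A"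
  using assms by (auto simp: unital_subring_def)

lemma unital_subring_zero: "unital_subring A \<Longrightarrow> 0 \<in> A"
  using unital_subring_diff[of A 1 1] by (simp add: unital_subring_one)

lemma unital_subring_uminus: "unital_subring A \<Longrightarrow> x \<in> A \<Longrightarrow> - x \<in> A"
  using unital_subring_diff[of A 0 x] by (simp add: unital_subring_zero)

lemma unital_subring_add: "unital_subring A \<Longrightarrow> x \<in> A \<Longrightarrow> y \<in> A \<Longrightarrow> x + y \<in> A"
  using unital_subring_diff[of A x "- y"] by (simp add: unital_subring_uminus)

lemma unital_subring_power: "unital_subring A \<Longrightarrow> x \<in> A \<Longrightarrow> x ^ n \<in> A"
  by (induction n) (auto simp: unital_subring_one unital_subring_mult)

lemma unital_subring_sum:
  "unital_subring A \<Longrightarrow> (\<And>i. i \<in> I \<Longrightarrow> f i \<in> A) \<Longrightarrow> sum f I \<in> A"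
  by (induction I rule: infinite_finite_induct)
    (auto simp: unital_subring_zero unital_subring_add)

lemmas unital_subring_closed = unital_subring_one unital_subring_zero unital_subring_add
  unital_subring_diff unital_subring_uminus unital_subring_mult unital_subring_power
  unital_subring_sum

lemma unital_subring_polys_over:
  assumes "unital_subring A"
  shows "unital_subring (polys_over A)"
  using assms unfolding unital_subring_def[of "polys_over A"]
  by (auto simp: polys_over_def coeff_mult intro!: unital_subring_closed)

lemma polys_over_monom: "unital_subring A \<Longrightarrow> c \<in> A \<Longrightarrow> monom c n \<in> polys_over A"
  by (auto simp: polys_over_def unital_subring_closed)

lemma polys_over_const: "unital_subring A \<Longrightarrow> c \<in> A \<Longrightarrow> [:c:] \<in> polys_over A"
  using polys_over_monom[of A c 0] by (simp add: monom_0)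

lemma polys_over_smult:
  "unital_subring A \<Longrightarrow> c \<in> A \<Longrightarrow> P \<in> polys_over A \<Longrightarrow> Polynomial.smult c P \<in> polys_over A"
  by (auto simp: polys_over_def unital_subring_closed)

lemma unital_subring_adjoin:
  assumes "unital_subring A"
  shows "unital_subring (adjoin A x)"
  unfolding unital_subring_def adjoin_def
proof (intro conjI ballI)
  note P = unital_subring_polys_over[OF assms]
  show "1 \<in> (\<lambda>P. poly P x) ` polys_over A"
    using unital_subring_one[OF P] by (intro image_eqI[where x = 1]) auto
  fix u v
  assume "u \<in> (\<lambda>P. poly P x) ` polys_over A" "v \<in> (\<lambda>P. poly P x) ` polys_over A"
  then obtain U V where UV: "U \<in> polys_over A" "V \<in> polys_over A" "u = poly U x" "v = poly V x"
    by auto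
  show "u - v \<in> (\<lambda>P. poly P x) ` polys_over A"
    using UV P by (intro image_eqI[where x = "U - V"]) (auto intro: unital_subring_diff)
  show "u * v \<in> (\<lambda>P. poly P x) ` polys_over A"
    using UV P by (intro image_eqI[where x = "U * V"]) (auto intro: unital_subring_mult)
qed

lemma subset_adjoin: "unital_subring A \<Longrightarrow> A \<subseteq> adjoin A x"
  unfolding adjoin_def by (auto intro!: image_eqI[where x = "[:c:]" for c] polys_over_const)

lemma mem_adjoin: "unital_subring A \<Longrightarrow> x \<in> adjoin A x"
  unfolding adjoin_def
  by (intro image_eqI[where x = "monom 1 1"] polys_over_monom)
    (auto simp: poly_monom unital_subring_one)

section \<open>Homomorphisms defined on a subring\<close>

lemma
  assumes "hom_on A h"
  shows hom_on_one: "h 1 = 1"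
    and hom_on_add: "x \<in> A \<Longrightarrow> y \<in> A \<Longrightarrow> h (x + y) = h x + h y"
    and hom_on_mult: "x \<in> A \<Longrightarrow> y \<in> A \<Longrightarrow> h (x * y) = h x * h y"
  using assms by (auto simp: hom_on_def)

lemma hom_on_zero: "unital_subring A \<Longrightarrow> hom_on A h \<Longrightarrow> h 0 = 0"
  using hom_on_add[of A h 0 0] by (simp add: unital_subring_zero)

lemma hom_on_power:
  "unital_subring A \<Longrightarrow> hom_on A h \<Longrightarrow> x \<in> A \<Longrightarrow> h (x ^ n) = h x ^ n"
  by (induction n) (auto simp: hom_on_one hom_on_mult unital_subring_power)

lemma hom_on_sum:
  assumes "unital_subring A" "hom_on A h" "\<And>i. i \<in> I \<Longrightarrow> f i \<in> A"
  shows "h (sum f I) = (\<Sum>i\<in>I. h (f i))"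
  using assms(3)
  by (induction I rule: infinite_finite_induct)
    (auto simp: hom_on_zero[OF assms(1,2)] hom_on_add[OF assms(2)] unital_subring_sum[OF assms(1)])

lemma hom_on_map_poly:
  fixes h :: "'a::comm_ring_1 \<Rightarrow> 'b::comm_ring_1"
  assumes A: "unital_subring A" and h: "hom_on A h"
  shows "hom_on (polys_over A) (map_poly h)"
  unfolding hom_on_def
proof (intro conjI ballI)
  note coeff_map = coeff_map_poly[of h, OF hom_on_zero[OF A h]]
  show "map_poly h 1 = 1"
    using hom_on_one[OF h] by simp
  fix P Q
  assume PQ: "P \<in> polys_over A" "Q \<in> polys_over A"
  show "map_poly h (P + Q) = map_poly h P + map_poly h Q"
    using PQ by (intro poly_eqI) (simp add: coeff_map polys_over_def hom_on_add[OF h])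
  show "map_poly h (P * Q) = map_poly h P * map_poly h Q"
    using PQ
    by (intro poly_eqI) (simp add: coeff_map coeff_mult polys_over_def hom_on_sum[OF A h] unital_subring_mult[OF A]
        hom_on_mult[OF h])
qed

text \<open>Long division by \<open>F\<close> without inverting its leading coefficient: each step
  multiplies by that coefficient first, which keeps all coefficients in \<open>A\<close>.\<close>

lemma pseudo_division:
  fixes F G :: "'a::idom poly"
  assumes A: "unital_subring A" and F: "F \<in> polys_over A" "F \<noteq> 0" and G: "G \<in> polys_over A"
  obtains e Q S where "Q \<in> polys_over A" "S \<in> polys_over A"
    "Polynomial.smult (lead_coeff F ^ e) G = Q * F + S" "S = 0 \<or> degree S < degree F"
proof -
  note PA = unital_subring_polys_over[OF A]
  have lF: "lead_coeff F \<in> A"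
    using F by (simp add: polys_over_def)
  have "\<exists>e Q S. Q \<in> polys_over A \<and> S \<in> polys_over A \<and>
      Polynomial.smult (lead_coeff F ^ e) G = Q * F + S \<and> (S = 0 \<or> degree S < degree F)"
    using G
  \<comment> \<open>The measure ranks the zero polynomial strictly below the nonzero constants,
    which \<open>degree\<close> alone would not do.\<close>
  proof (induction "if G = 0 then 0 else Suc (degree G)" arbitrary: G rule: less_induct)
    case less
    show ?case
    proof (cases "G = 0 \<or> degree G < degree F")
      case True
      then show ?thesis
        using less.prems unital_subring_zero[OF PA]
        by (intro exI[of _ 0] exI[of _ G]) auto
    next
      case False
      \<comment> \<open>\<open>M\<close> is chosen so that \<open>M * F\<close> has the same leading
        term as \<open>lead_coeff F\<close> times \<open>G\<close>.\<close>
      define M where "M = monom (lead_coeff G) (degree G - degree F)"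
      define H where "H = Polynomial.smult (lead_coeff F) G - M * F"
      have M: "M \<in> polys_over A"
        unfolding M_def using less.prems by (intro polys_over_monom A) (simp add: polys_over_def)
      have H: "H \<in> polys_over A"
        unfolding H_def using M less.prems F lF
        by (intro unital_subring_diff[OF PA] unital_subring_mult[OF PA] polys_over_smult A) auto
      have lG: "lead_coeff G \<noteq> 0"
        using False by auto
      have dM: "degree (M * F) = degree G"
        using False F lG by (subst degree_mult_eq) (auto simp: M_def degree_monom_eq)
      have "degree H \<le> degree G"
        unfolding H_def using dM
        by (intro degree_diff_le degree_smult_le order.trans[OF degree_smult_le]) auto
      moreover have "coeff (M * F) (degree G) = lead_coeff G * lead_coeff F"
        using lead_coeff_mult[of M F] dM lG by (simp add: M_def degree_monom_eq)
      then have "coeff H (degree G) = 0"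
        unfolding H_def by simp
      ultimately have "H = 0 \<or> degree H < degree G"
        by (metis leading_coeff_0_iff le_neq_implies_less)
      then have "(if H = 0 then 0 else Suc (degree H)) < (if G = 0 then 0 else Suc (degree G))"
        using False by auto
      then obtain e Q S where eQS: "Q \<in> polys_over A" "S \<in> polys_over A"
        "Polynomial.smult (lead_coeff F ^ e) H = Q * F + S" "S = 0 \<or> degree S < degree F"
        using less.hyps[of H] H by blast
      have "Polynomial.smult (lead_coeff F ^ Suc e) G = Polynomial.smult (lead_coeff F ^ e) (H + M * F)"
        by (simp add: H_def mult.commute)
      also have "\<dots> = (Q + Polynomial.smult (lead_coeff F ^ e) M) * F + S"
        using eQS(3) by (simp add: smult_add_right distrib_right)
      finally show ?thesis
        using eQS M lF A
        by (intro exI[of _ "Suc e"] exI[of _ "Q + Polynomial.smult (lead_coeff F ^ e) M"] exI[of _ S])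
          (auto intro!: unital_subring_add[OF PA] polys_over_smult unital_subring_power)
    qed
  qed
  then show thesis
    using that by blast
qed

text \<open>\<open>A[x]\<close> is the quotient of \<open>A[T]\<close> by the relations of
  \<open>x\<close>. Applying \<open>h\<close> to coefficients and sending \<open>T\<close> to
  \<open>\<xi>\<close> descends to it once \<open>\<xi>\<close> is a root of the image of every
  relation.\<close>

lemma extend_hom_adjoin:
  fixes h :: "'a::comm_ring_1 \<Rightarrow> 'b::comm_ring_1"
  assumes A: "unital_subring A" and h: "hom_on A h"
    and wd: "\<And>P. P \<in> polys_over A \<Longrightarrow> poly P x = 0 \<Longrightarrow> poly (map_poly h P) \<xi> = 0"
  obtains h' where "hom_on (adjoin A x) h'"
    "\<And>P. P \<in> polys_over A \<Longrightarrow> h' (poly P x) = poly (map_poly h P) \<xi>"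
    "\<And>y. y \<in> A \<Longrightarrow> h' y = h y"
proof -
  note PA = unital_subring_polys_over[OF A]
  note hP = hom_on_map_poly[OF A h]
  define h' where "h' y = poly (map_poly h (SOME P. P \<in> polys_over A \<and> poly P x = y)) \<xi>" for y
  have h': "h' (poly P x) = poly (map_poly h P) \<xi>" if P: "P \<in> polys_over A" for P
  proof -
    define Q where "Q = (SOME Q. Q \<in> polys_over A \<and> poly Q x = poly P x)"
    have Q: "Q \<in> polys_over A" "poly Q x = poly P x"
      using someI[of "\<lambda>Q. Q \<in> polys_over A \<and> poly Q x = poly P x" P] P
      by (auto simp: Q_def)
    have "poly (map_poly h (Q - P)) \<xi> = 0"
      using Q P by (intro wd) (auto intro: unital_subring_diff[OF PA])
    moreover have "map_poly h Q = map_poly h (Q - P) + map_poly h P"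
      using hom_on_add[OF hP, of "Q - P" P] Q P by (simp add: unital_subring_diff[OF PA])
    ultimately show ?thesis
      by (simp add: h'_def Q_def)
  qed
  have "hom_on (adjoin A x) h'"
    unfolding hom_on_def
  proof (intro conjI ballI)
    show "h' 1 = 1"
      using h'[of 1] hom_on_one[OF hP] unital_subring_one[OF PA] by simp
    fix u v
    assume "u \<in> adjoin A x" "v \<in> adjoin A x"
    then obtain U V where UV: "U \<in> polys_over A" "V \<in> polys_over A" "u = poly U x" "v = poly V x"
      by (auto simp: adjoin_def)
    show "h' (u + v) = h' u + h' v"
      using h'[of "U + V"] UV h' by (simp add: unital_subring_add[OF PA] hom_on_add[OF hP])
    show "h' (u * v) = h' u * h' v"
      using h'[of "U * V"] UV h' by (simp add: unital_subring_mult[OF PA] hom_on_mult[OF hP])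
  qed
  moreover have "h' y = h y" if "y \<in> A" for y
    using h'[of "[:y:]"] polys_over_const[OF A that] hom_on_zero[OF A h]
    by (simp add: map_poly_pCons)
  ultimately show thesis
    using that h' by blast
qed

text \<open>A nonconstant \<open>p\<close> even takes the value 1, since \<open>p - 1\<close> has a
  root.\<close>

lemma exists_nonroot:
  fixes p :: "'k::alg_closed_field poly"
  assumes "p \<noteq> 0"
  shows "\<exists>x. poly p x \<noteq> 0"
proof (cases "degree p = 0")
  case True
  then show ?thesis
    using assms by (auto elim!: degree_eq_zeroE)
next
  case False
  then have "degree (p - 1) > 0"
    using degree_add_le_max[of "p - 1" 1] by simp
  then obtain x where "poly (p - 1) x = 0"
    using alg_closed_imp_poly_has_root by blast
  then show ?thesis
    by (intro exI[of _ x]) auto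
qed

text \<open>Every nonzero \<open>b\<close> in \<open>A[x]\<close> divides a nonzero \<open>d\<close>
  in \<open>A\<close> when \<open>x\<close> is algebraic over \<open>A\<close>. Any extension of a
  homomorphism that does not kill \<open>d\<close> then cannot kill \<open>b\<close>.\<close>

lemma algebraic_divides_constant:
  fixes F :: "'a::idom poly"
  assumes A: "unital_subring A" and b: "b \<in> adjoin A x" "b \<noteq> 0"
    and F: "F \<in> polys_over A" "F \<noteq> 0" "poly F x = 0"
    and F_min: "\<And>G. G \<in> polys_over A \<Longrightarrow> G \<noteq> 0 \<Longrightarrow> poly G x = 0 \<Longrightarrow> degree F \<le> degree G"
  obtains d u where "d \<in> A" "d \<noteq> 0" "u \<in> adjoin A x" "d = b * u"
proof -
  note PA = unital_subring_polys_over[OF A]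
  note XA = unital_subring_adjoin[OF A, of x]
  have X: "poly P x \<in> adjoin A x" if "P \<in> polys_over A" for P
    using that by (auto simp: adjoin_def)
  \<comment> \<open>The polynomials whose value at \<open>x\<close> is a nonzero multiple of
    \<open>b\<close> in \<open>A[x]\<close>. One of least degree will turn out to be
    constant.\<close>
  define T where "T P \<longleftrightarrow> P \<in> polys_over A \<and> poly P x \<noteq> 0 \<and> (\<exists>u\<in>adjoin A x. poly P x = b * u)" for P
  obtain G where "G \<in> polys_over A" "b = poly G x"
    using b by (auto simp: adjoin_def)
  then have "T G"
    unfolding T_def using b unital_subring_one[OF XA] by (auto intro!: bexI[of _ 1])
  then obtain P where P: "T P" and P_min: "\<And>Q. T Q \<Longrightarrow> degree P \<le> degree Q"
    using ex_has_least_nat[of T G degree] by blast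
  obtain u where u: "u \<in> adjoin A x" "poly P x = b * u"
    using P by (auto simp: T_def)
  have PP: "P \<in> polys_over A" "poly P x \<noteq> 0" "P \<noteq> 0"
    using P by (auto simp: T_def)
  \<comment> \<open>Reducing \<open>P\<close> modulo \<open>F\<close> changes its value at
    \<open>x\<close> only by a nonzero factor from \<open>A\<close>, so the remainder still
    satisfies \<open>T\<close>.\<close>
  have "degree P < degree F"
  proof -
    obtain e Q S where *: "Q \<in> polys_over A" "S \<in> polys_over A"
      "Polynomial.smult (lead_coeff F ^ e) P = Q * F + S" "S = 0 \<or> degree S < degree F"
      using pseudo_division[OF A F(1,2) PP(1)] .
    have S: "poly S x = lead_coeff F ^ e * poly P x"
      using arg_cong[OF *(3), of "\<lambda>p. poly p x"] F(3) by simp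
    have "lead_coeff F ^ e \<in> adjoin A x"
      using F(1) subset_adjoin[OF A] by (auto simp: polys_over_def intro!: unital_subring_power[OF XA])
    then have "T S"
      unfolding T_def using * S PP F(2) u
      by (auto intro!: bexI[of _ "lead_coeff F ^ e * u"] unital_subring_mult[OF XA])
    then show ?thesis
      using P_min[of S] *(4) S PP F(2) by auto
  qed
  \<comment> \<open>Reducing \<open>F\<close> modulo \<open>P\<close> leaves a remainder whose value
    at \<open>x\<close> is a multiple of \<open>b\<close>. By both minimalities it is the zero
    polynomial, and then the quotient \<open>Q\<close> is a relation of \<open>x\<close> of smaller
    degree than \<open>F\<close>.\<close>
  moreover have "degree P = 0"
  proof (rule ccontr)
    assume D: "degree P \<noteq> 0"
    obtain e Q S where *: "Q \<in> polys_over A" "S \<in> polys_over A"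
      "Polynomial.smult (lead_coeff P ^ e) F = Q * P + S" "S = 0 \<or> degree S < degree P"
      using pseudo_division[OF A PP(1,3) F(1)] .
    have S: "poly S x = b * (u * - poly Q x)"
      using arg_cong[OF *(3), of "\<lambda>p. poly p x"] F(3) u(2)
      by (simp add: algebra_simps eq_neg_iff_add_eq_0)
    have "poly S x = 0"
    proof (rule ccontr)
      assume "poly S x \<noteq> 0"
      moreover have "u * - poly Q x \<in> adjoin A x"
        using u *(1) X by (intro unital_subring_mult[OF XA] unital_subring_uminus[OF XA]) auto
      ultimately have "T S"
        unfolding T_def using *(2) S by blast
      then show False
        using P_min[of S] *(4) \<open>poly S x \<noteq> 0\<close> by auto
    qed
    then have "S = 0"
      using F_min[of S] *(2,4) \<open>degree P < degree F\<close> by force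
    then have QP: "Polynomial.smult (lead_coeff P ^ e) F = Q * P"
      using *(3) by simp
    have "poly Q x * poly P x = lead_coeff P ^ e * poly F x"
      using arg_cong[OF QP[symmetric], of "\<lambda>p. poly p x"] by (simp only: poly_mult poly_smult)
    then have "poly Q x = 0"
      using F(3) PP(2) by simp
    moreover have "Q \<noteq> 0"
      using QP PP F(2) by auto
    ultimately have "degree F \<le> degree Q"
      using F_min *(1) by blast
    moreover have "degree F = degree Q + degree P"
      using arg_cong[OF QP, of degree] PP \<open>Q \<noteq> 0\<close> by (simp add: degree_mult_eq)
    ultimately show False
      using D by simp
  qed
  then obtain d where "P = [:d:]"
    by (auto elim: degree_eq_zeroE)
  then show thesis
    using that[of d u] PP u by (auto simp: polys_over_def dest: spec[of _ 0])
qed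

text \<open>The generic extension lemma behind Zariski's form of the Nullstellensatz: prescribing
  \<open>h a \<noteq> 0\<close> for a single element below suffices to extend \<open>h\<close> without killing \<open>b\<close>.\<close>

lemma generic_extension:
  fixes A :: "'a::idom set"
  assumes A: "unital_subring A" and b: "b \<in> adjoin A x" "b \<noteq> 0"
  obtains a where "a \<in> A" "a \<noteq> 0"
    "\<And>h :: 'a \<Rightarrow> 'k::alg_closed_field. hom_on A h \<Longrightarrow> h a \<noteq> 0 \<Longrightarrow>
       \<exists>h'. hom_on (adjoin A x) h' \<and> (\<forall>y\<in>A. h' y = h y) \<and> h' b \<noteq> 0"
proof -
  note PA = unital_subring_polys_over[OF A]
  obtain G where G: "G \<in> polys_over A" "b = poly G x"
    using b by (auto simp: adjoin_def)
  have coeff_map: "coeff (map_poly h P) i = h (coeff P i)" if "hom_on A h" for P i and h :: "'a \<Rightarrow> 'k"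
    using coeff_map_poly[of h] hom_on_zero[OF A that] by simp
  show thesis
  proof (cases "\<exists>F. F \<in> polys_over A \<and> F \<noteq> 0 \<and> poly F x = 0")
    \<comment> \<open>Here \<open>x\<close> is transcendental over \<open>A\<close>: any
      \<open>\<xi>\<close> is admissible, and it only has to avoid the roots of the image of
      \<open>G\<close>.\<close>
    case False
    show thesis
    proof (rule that[of "lead_coeff G"])
      show "lead_coeff G \<in> A" "lead_coeff G \<noteq> 0"
        using G b by (auto simp: polys_over_def)
      fix h :: "'a \<Rightarrow> 'k"
      assume h: "hom_on A h" "h (lead_coeff G) \<noteq> 0"
      have "map_poly h G \<noteq> 0"
        using coeff_map[OF h(1), of G "degree G"] h(2) by auto
      then obtain \<xi> where \<xi>: "poly (map_poly h G) \<xi> \<noteq> 0"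
        using exists_nonroot by blast
      have "poly (map_poly h P) \<xi> = 0" if "P \<in> polys_over A" "poly P x = 0" for P
        using False that by auto
      then obtain h' where "hom_on (adjoin A x) h'"
        "\<And>P. P \<in> polys_over A \<Longrightarrow> h' (poly P x) = poly (map_poly h P) \<xi>"
        "\<And>y. y \<in> A \<Longrightarrow> h' y = h y"
        using extend_hom_adjoin[OF A h(1), of x \<xi>] by blast
      then show "\<exists>h'. hom_on (adjoin A x) h' \<and> (\<forall>y\<in>A. h' y = h y) \<and> h' b \<noteq> 0"
        using G \<xi> by auto
    qed
  next
    case True
    then obtain F where F: "F \<in> polys_over A" "F \<noteq> 0" "poly F x = 0"
      and F_min: "\<And>G. G \<in> polys_over A \<Longrightarrow> G \<noteq> 0 \<Longrightarrow> poly G x = 0 \<Longrightarrow> degree F \<le> degree G"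
      using ex_has_least_nat[of "\<lambda>F. F \<in> polys_over A \<and> F \<noteq> 0 \<and> poly F x = 0" _ degree] by blast
    obtain d u where d: "d \<in> A" "d \<noteq> 0" and u: "u \<in> adjoin A x" "d = b * u"
      using algebraic_divides_constant[OF A b F F_min] by blast
    have lF: "lead_coeff F \<in> A"
      using F by (simp add: polys_over_def)
    show thesis
    \<comment> \<open>The first factor keeps the image of \<open>F\<close> nonconstant, so that it
      has a root; the second keeps the image of \<open>b\<close> nonzero.\<close>
    proof (rule that[of "lead_coeff F * d"])
      show "lead_coeff F * d \<in> A" "lead_coeff F * d \<noteq> 0"
        using lF d F by (auto intro: unital_subring_mult[OF A])
      fix h :: "'a \<Rightarrow> 'k"
      assume h: "hom_on A h" and "h (lead_coeff F * d) \<noteq> 0"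
      then have hF: "h (lead_coeff F) \<noteq> 0" and hd: "h d \<noteq> 0"
        using hom_on_mult[OF h lF d(1)] by auto
      note hP = hom_on_map_poly[OF A h]
      have "degree F \<noteq> 0"
        using F(2,3) by (metis degree_eq_zeroE pCons_0_0 poly_pCons mult_zero_right add_0_right poly_0)
      moreover have "degree F \<le> degree (map_poly h F)"
        using hF coeff_map[OF h] by (intro le_degree) simp
      ultimately obtain \<xi> where \<xi>: "poly (map_poly h F) \<xi> = 0"
        using alg_closed_imp_poly_has_root[of "map_poly h F"] by auto
      \<comment> \<open>By minimality of \<open>F\<close>, a power of its leading coefficient times
        \<open>P\<close> is a multiple of \<open>F\<close>, and \<open>h\<close> does not kill that
        power.\<close>
      have "poly (map_poly h P) \<xi> = 0" if P: "P \<in> polys_over A" "poly P x = 0" for P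
      proof -
        obtain e Q S where *: "Q \<in> polys_over A" "S \<in> polys_over A"
          "Polynomial.smult (lead_coeff F ^ e) P = Q * F + S" "S = 0 \<or> degree S < degree F"
          using pseudo_division[OF A F(1,2) P(1)] .
        have "poly S x = 0"
          using arg_cong[OF *(3), of "\<lambda>p. poly p x"] F(3) P(2) by simp
        then have "S = 0"
          using F_min[of S] *(2,4) by force
        then have "[:lead_coeff F ^ e:] * P = Q * F"
          using *(3) by simp
        moreover have "[:lead_coeff F ^ e:] \<in> polys_over A"
          by (intro polys_over_const unital_subring_power A lF)
        ultimately have "map_poly h [:lead_coeff F ^ e:] * map_poly h P = map_poly h Q * map_poly h F"
          using hom_on_mult[OF hP] *(1) P(1) F(1) by metis
        then have "Polynomial.smult (h (lead_coeff F) ^ e) (map_poly h P) = map_poly h Q * map_poly h F"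
          using hom_on_zero[OF A h] by (simp add: map_poly_pCons hom_on_power[OF A h lF])
        then have "poly (Polynomial.smult (h (lead_coeff F) ^ e) (map_poly h P)) \<xi> = 0"
          using \<xi> by simp
        then show ?thesis
          using hF by simp
      qed
      then obtain h' where h': "hom_on (adjoin A x) h'" "\<And>y. y \<in> A \<Longrightarrow> h' y = h y"
        using extend_hom_adjoin[OF A h, of x \<xi>] by blast
      moreover have "h' b \<noteq> 0"
        using hom_on_mult[OF h'(1) b(1) u(1)] h'(2)[OF d(1)] u(2) hd by auto
      ultimately show "\<exists>h'. hom_on (adjoin A x) h' \<and> (\<forall>y\<in>A. h' y = h y) \<and> h' b \<noteq> 0"
        by blast
    qed
  qed
qed

text \<open>A form of the Nullstellensatz, with \<open>e\<close> the structure map of the algebra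
  and \<open>h\<close> an algebra homomorphism to the base field. Allowing every nonzero
  \<open>b\<close> makes the induction on generators work: \<open>generic_extension\<close> trades
  \<open>b\<close> in \<open>S[x]\<close> for a nonzero \<open>a\<close> in
  \<open>S\<close>.\<close>

lemma finitely_generated_homs:
  fixes e :: "'k::alg_closed_field \<Rightarrow> 'r::field"
  assumes e1: "e 1 = 1" and e_add: "\<And>c d. e (c + d) = e c + e d"
    and e_mult: "\<And>c d. e (c * d) = e c * e d" and "finite X"
  obtains S where "unital_subring S" "range e \<subseteq> S" "X \<subseteq> S"
    "\<And>b. b \<in> S \<Longrightarrow> b \<noteq> 0 \<Longrightarrow> \<exists>h. hom_on S h \<and> (\<forall>c. h (e c) = c) \<and> h b \<noteq> 0"
proof -
  have "\<exists>S. unital_subring S \<and> range e \<subseteq> S \<and> X \<subseteq> S \<and>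
      (\<forall>b\<in>S. b \<noteq> 0 \<longrightarrow> (\<exists>h. hom_on S h \<and> (\<forall>c. h (e c) = c) \<and> h b \<noteq> 0))"
    using \<open>finite X\<close>
  proof (induction X rule: finite_induct)
    \<comment> \<open>Without generators \<open>S\<close> is the image of the base field, and
      \<open>h\<close> is the inverse of the embedding \<open>e\<close>.\<close>
    case empty
    have "e 0 + e 0 = e 0 + 0"
      using e_add[of 0 0] by (simp only: add_0_right)
    then have e0: "e 0 = 0"
      by (simp only: add_left_cancel)
    have e_diff: "e c - e d = e (c - d)" for c d
      using e_add[of "c - d" d] by (simp add: eq_diff_eq)
    have "inj e"
    proof (rule injI, rule ccontr)
      fix c d
      assume "e c = e d" "c \<noteq> d"
      then have "e (c - d) * e (inverse (c - d)) = 1"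
        using e_mult[of "c - d" "inverse (c - d)"] e1 by simp
      moreover have "e (c - d) = 0"
        using e_diff[of c d] \<open>e c = e d\<close> by simp
      ultimately show False
        by simp
    qed
    then have inv: "inv_into UNIV e (e c) = c" for c
      by simp
    have "1 \<in> range e"
      by (metis e1 rangeI)
    then have "unital_subring (range e)"
      unfolding unital_subring_def by (auto simp: e_diff e_mult[symmetric])
    moreover have "hom_on (range e) (inv_into UNIV e)"
      unfolding hom_on_def using inv[of 1] e1
      by (auto simp: inv e_add[symmetric] e_mult[symmetric])
    moreover have "inv_into UNIV e b \<noteq> 0" if "b \<in> range e" "b \<noteq> 0" for b
      using that e0 inv by auto
    ultimately show ?case
      using inv by (intro exI[of _ "range e"]) blast
  next
    case (insert x X)
    then obtain S where S: "unital_subring S" "range e \<subseteq> S" "X \<subseteq> S"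
      "\<And>b. b \<in> S \<Longrightarrow> b \<noteq> 0 \<Longrightarrow> \<exists>h. hom_on S h \<and> (\<forall>c. h (e c) = c) \<and> h b \<noteq> 0"
      by blast
    have "\<exists>h. hom_on (adjoin S x) h \<and> (\<forall>c. h (e c) = c) \<and> h b \<noteq> 0"
      if b: "b \<in> adjoin S x" "b \<noteq> 0" for b
    proof -
      obtain a where a: "a \<in> S" "a \<noteq> 0"
        "\<And>h :: 'r \<Rightarrow> 'k. hom_on S h \<Longrightarrow> h a \<noteq> 0 \<Longrightarrow>
           \<exists>h'. hom_on (adjoin S x) h' \<and> (\<forall>y\<in>S. h' y = h y) \<and> h' b \<noteq> 0"
        using generic_extension[OF S(1) b] by blast
      obtain h where h: "hom_on S h" "\<And>c. h (e c) = c" "h a \<noteq> 0"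
        using S(4)[OF a(1,2)] by blast
      then obtain h' where "hom_on (adjoin S x) h'" "\<forall>y\<in>S. h' y = h y" "h' b \<noteq> 0"
        using a(3) by blast
      then show ?thesis
        using h(2) S(2) by (intro exI[of _ h']) (auto simp: image_subset_iff)
    qed
    then show ?case
      using unital_subring_adjoin[OF S(1), of x] subset_adjoin[OF S(1), of x] mem_adjoin[OF S(1), of x] S(2,3)
      by (intro exI[of _ "adjoin S x"]) blast
  qed
  then show thesis
    using that by blast
qed

section \<open>The variety of a generic point\<close>

text \<open>\<open>value_at e n m a p r\<close>: some polynomial over \<open>'k\<close> inducing the polynomial function \<open>p\<close> takes the
  value \<open>r\<close> at the point \<open>a\<close> with entries in \<open>'r\<close>. This avoids a syntax of polynomials.\<close>

inductive value_at ::
  "('k::comm_ring_1 \<Rightarrow> 'r::comm_ring_1) \<Rightarrow> nat \<Rightarrow> nat \<Rightarrow> (nat \<Rightarrow> nat \<Rightarrow> 'r) \<Rightarrow> ('k mat \<Rightarrow> 'k) \<Rightarrow> 'r \<Rightarrow> bool"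
  for e n m a where
  const: "value_at e n m a (\<lambda>A. c) (e c)"
| entry: "i < n \<Longrightarrow> j < m \<Longrightarrow> value_at e n m a (\<lambda>A. A $$ (i, j)) (a i j)"
| add: "value_at e n m a p r \<Longrightarrow> value_at e n m a q s \<Longrightarrow> value_at e n m a (\<lambda>A. p A + q A) (r + s)"
| mult: "value_at e n m a p r \<Longrightarrow> value_at e n m a q s \<Longrightarrow> value_at e n m a (\<lambda>A. p A * q A) (r * s)"

definition closure_of_point ::
  "('k::comm_ring_1 \<Rightarrow> 'r::comm_ring_1) \<Rightarrow> nat \<Rightarrow> nat \<Rightarrow> (nat \<Rightarrow> nat \<Rightarrow> 'r) \<Rightarrow> 'k mat set" where
  "closure_of_point e n m a = {A \<in> carrier_mat n m. \<forall>p. value_at e n m a p 0 \<longrightarrow> p A = 0}"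

lemma value_at_polynomial: "value_at e n m a p r \<Longrightarrow> p \<in> polynomial_functions n m"
  by (induction rule: value_at.induct) (auto intro: polynomial_functions.intros)

lemma polynomial_value_at: "p \<in> polynomial_functions n m \<Longrightarrow> \<exists>r. value_at e n m a p r"
  by (induction rule: polynomial_functions.induct) (blast intro: value_at.intros)+

lemma closed_closure_of_point: "zariski_closed n m (closure_of_point e n m a)"
  unfolding zariski_closed_def closure_of_point_def
  by (rule exI[of _ "{p. value_at e n m a p 0}"]) (auto dest: value_at_polynomial)

lemma value_at_sum:
  assumes "e 0 = 0" "finite I" "\<And>i. i \<in> I \<Longrightarrow> value_at e n m a (p i) (r i)"
  shows "value_at e n m a (\<lambda>A. \<Sum>i\<in>I. p i A) (\<Sum>i\<in>I. r i)"
  using assms(2,3)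
proof (induction I rule: finite_induct)
  case empty
  then show ?case
    using value_at.const[of e n m a 0] assms(1) by simp
next
  case (insert i I)
  then show ?case
    using value_at.add[of e n m a "p i" "r i" "\<lambda>A. \<Sum>i\<in>I. p i A"] by simp
qed

lemma value_at_diff:
  assumes "e (- 1) = - 1" "value_at e n m a p r" "value_at e n m a q s"
  shows "value_at e n m a (\<lambda>A. p A - q A) (r - s)"
  using value_at.add[OF assms(2) value_at.mult[OF value_at.const[of e n m a "- 1"] assms(3)]] assms(1)
  by simp

text \<open>If \<open>r \<noteq> 0\<close>, some homomorphism on a ring containing the entries of
  \<open>a\<close> does not kill \<open>r\<close>. Applied to these entries, it gives a point of the
  closure at which \<open>p\<close> does not vanish.\<close>

lemma vanishing_on_closure:
  fixes e :: "'k::alg_closed_field \<Rightarrow> 'r::field"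
  assumes e: "e 1 = 1" "\<And>c d. e (c + d) = e c + e d" "\<And>c d. e (c * d) = e c * e d"
    and p: "value_at e n m a p r" and vanish: "\<And>A. A \<in> closure_of_point e n m a \<Longrightarrow> p A = 0"
  shows "r = 0"
proof (rule ccontr)
  assume "r \<noteq> 0"
  define X where "X = (\<lambda>(i, j). a i j) ` ({..<n} \<times> {..<m})"
  obtain S where S: "unital_subring S" "range e \<subseteq> S" "X \<subseteq> S"
    and S_homs: "\<And>b. b \<in> S \<Longrightarrow> b \<noteq> 0 \<Longrightarrow> \<exists>h. hom_on S h \<and> (\<forall>c. h (e c) = c) \<and> h b \<noteq> 0"
    using finitely_generated_homs[OF e, where X = X] unfolding X_def by blast
  have mem: "s \<in> S" if "value_at e n m a q s" for q s
    using that
    by (induction rule: value_at.induct)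
      (use S in \<open>auto simp: X_def intro!: unital_subring_add unital_subring_mult\<close>)
  obtain h where h: "hom_on S h" "\<And>c. h (e c) = c" "h r \<noteq> 0"
    using S_homs[OF mem[OF p] \<open>r \<noteq> 0\<close>] by blast
  define A where "A = mat n m (\<lambda>(i, j). h (a i j))"
  \<comment> \<open>Homomorphisms commute with polynomial evaluation; the case \<open>s = 0\<close>
    puts \<open>A\<close> into the closure.\<close>
  have eval: "q A = h s" if "value_at e n m a q s" for q s
    using that
    by (induction rule: value_at.induct)
      (auto simp: A_def h(2) hom_on_add[OF h(1)] hom_on_mult[OF h(1)] mem)
  have "A \<in> closure_of_point e n m a"
    unfolding closure_of_point_def using eval hom_on_zero[OF S(1) h(1)]
    by (auto simp: A_def)
  then show False
    using vanish eval[OF p] h(3) by auto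
qed

text \<open>The polynomials vanishing on the closure are those vanishing at \<open>a\<close>, and
  they form a prime ideal because the values lie in a field.\<close>

lemma irreducible_closure_of_point:
  fixes e :: "'k::alg_closed_field \<Rightarrow> 'r::field"
  assumes e: "e 1 = 1" "\<And>c d. e (c + d) = e c + e d" "\<And>c d. e (c * d) = e c * e d"
  shows "irreducible_variety n m (closure_of_point e n m a)"
  unfolding irreducible_variety_def
proof (intro conjI allI impI closed_closure_of_point)
  let ?V = "closure_of_point e n m a"
  note vanishing = vanishing_on_closure[OF e]
  \<comment> \<open>On an empty set the constant 1 would vanish, hence also its value
    \<open>e 1\<close>.\<close>
  show "?V \<noteq> {}"
    using vanishing[OF value_at.const[of e n m a 1]] e(1) by auto
  \<comment> \<open>One of the equations of a proper closed subset fails somewhere on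
    \<open>?V\<close>, so its value at the generic point is nonzero.\<close>
  have separate: "\<exists>q r. value_at e n m a q r \<and> (\<forall>A\<in>W. q A = 0) \<and> r \<noteq> 0"
    if W: "zariski_closed n m W" "W \<subseteq> ?V" "?V \<noteq> W" for W
  proof -
    obtain P where P: "P \<subseteq> polynomial_functions n m" "W = {A \<in> carrier_mat n m. \<forall>p\<in>P. p A = 0}"
      using W(1) by (auto simp: zariski_closed_def)
    obtain A where A: "A \<in> ?V" "A \<notin> W"
      using W by auto
    then obtain q where q: "q \<in> P" "q A \<noteq> 0"
      using P(2) by (auto simp: closure_of_point_def)
    then obtain r where r: "value_at e n m a q r"
      using polynomial_value_at P(1) by blast
    then have "r \<noteq> 0"
      using A(1) q(2) by (auto simp: closure_of_point_def)
    then show ?thesis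
      using r q(1) P(2) by blast
  qed
  fix V1 V2
  assume V: "zariski_closed n m V1 \<and> zariski_closed n m V2 \<and> ?V = V1 \<union> V2"
  show "?V = V1 \<or> ?V = V2"
  proof (rule ccontr)
    assume "\<not> (?V = V1 \<or> ?V = V2)"
    then obtain q1 r1 q2 r2 where q: "value_at e n m a q1 r1" "\<forall>A\<in>V1. q1 A = 0" "r1 \<noteq> 0"
      "value_at e n m a q2 r2" "\<forall>A\<in>V2. q2 A = 0" "r2 \<noteq> 0"
      using separate[of V1] separate[of V2] V by blast
    have "r1 * r2 = 0"
      using V q(2,5) by (intro vanishing[OF value_at.mult[OF q(1,4)]]) auto
    then show False
      using q by simp
  qed
qed

section \<open>Linear relations of a finite family\<close>

context vector_space
begin

text \<open>Coefficients are attached to indices, since rows of a matrix may repeat. An injective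
  subfamily with the same image reduces this to sets, with coefficient 0 at the other
  indices.\<close>

lemma span_family:
  assumes "finite I"
  shows "x \<in> span (v ` I) \<longleftrightarrow> (\<exists>d. x = (\<Sum>i\<in>I. scale (d i) (v i)))"
proof
  assume "x \<in> span (v ` I)"
  moreover obtain J where J: "J \<subseteq> I" "inj_on v J" "v ` I = v ` J"
    using subset_image_inj[of "v ` I" v I] by auto
  ultimately obtain u where "x = (\<Sum>y\<in>v ` J. scale (u y) y)"
    using span_finite[of "v ` J"] finite_subset[OF J(1) assms] by auto
  then have "x = (\<Sum>i\<in>J. scale (u (v i)) (v i))"
    using J(2) by (simp add: sum.reindex)
  also have "\<dots> = (\<Sum>i\<in>I. scale (if i \<in> J then u (v i) else 0) (v i))"
    using J(1) assms by (intro sum.mono_neutral_cong_left) auto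
  finally show "\<exists>d. x = (\<Sum>i\<in>I. scale (d i) (v i))"
    by (intro exI[of _ "\<lambda>i. if i \<in> J then u (v i) else 0"])
next
  assume "\<exists>d. x = (\<Sum>i\<in>I. scale (d i) (v i))"
  then show "x \<in> span (v ` I)"
    by (auto intro: span_sum span_scale span_base)
qed

lemma independent_family:
  assumes "finite I" "inj_on v I" "independent (v ` I)"
    and "(\<Sum>i\<in>I. scale (c i) (v i)) = 0" "i \<in> I"
  shows "c i = 0"
proof -
  have "(\<Sum>y\<in>v ` I. scale (c (the_inv_into I v y)) y) = 0"
    using assms by (simp add: sum.reindex the_inv_into_f_f)
  then have "c (the_inv_into I v (v i)) = 0"
    using assms by (intro independentD[OF assms(3)]) auto
  then show ?thesis
    using assms by (simp add: the_inv_into_f_f)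
qed

lemma dim_span_family:
  assumes "finite I"
    and indep: "\<And>c i. (\<Sum>i\<in>I. scale (c i) (v i)) = 0 \<Longrightarrow> i \<in> I \<Longrightarrow> c i = 0"
  shows "dim (span (v ` I)) = card I"
proof -
  have inj: "inj_on v I"
  proof (rule inj_onI, rule ccontr)
    fix i j
    assume ij: "i \<in> I" "j \<in> I" "v i = v j" "i \<noteq> j"
    \<comment> \<open>A repeated vector would give the nontrivial relation with coefficients 1 and
      -1.\<close>
    define c where "c l = (if l = i then 1 else if l = j then - 1 else (0::'a))" for l
    have "(\<Sum>l\<in>I. scale (c l) (v l)) = (\<Sum>l\<in>{i, j}. scale (c l) (v l))"
      using assms(1) ij by (intro sum.mono_neutral_right) (auto simp: c_def)
    also have "\<dots> = 0"
      using ij by (simp add: c_def)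
    finally show False
      using indep[of c i] ij by (simp add: c_def)
  qed
  have "independent (v ` I)"
  proof (rule independent_if_scalars_zero)
    fix f y
    assume *: "(\<Sum>y\<in>v ` I. scale (f y) y) = 0" "y \<in> v ` I"
    then show "f y = 0"
      using indep[of "\<lambda>i. f (v i)"] inj by (auto simp: sum.reindex)
  qed (use assms in auto)
  then show ?thesis
    using inj by (simp add: dim_eq_card_independent card_image)
qed

lemma basis_coordinates_unique:
  assumes "distinct ls" "independent (set ls)"
    and "(\<Sum>j<length ls. scale (c j) (ls ! j)) = (\<Sum>j<length ls. scale (d j) (ls ! j))"
    and "j < length ls"
  shows "c j = d j"
proof -
  have set: "(!) ls ` {..<length ls} = set ls"
    by (auto simp: set_conv_nth)
  have "(\<Sum>j<length ls. scale (c j - d j) (ls ! j)) = 0"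
    using assms(3) by (simp add: scale_left_diff_distrib sum_subtractf)
  then have "c j - d j = 0"
    using assms set by (intro independent_family[of "{..<length ls}" "(!) ls"])
      (auto simp: inj_on_def nth_eq_iff_index_eq)
  then show ?thesis
    by simp
qed

text \<open>The relations of a family form a subspace with a reduced echelon basis \<open>a\<close>, the pivots being
  the indices outside a maximal independent subfamily.\<close>

lemma relations_echelon_basis:
  fixes v :: "nat \<Rightarrow> 'b" and m :: nat
  defines "k \<equiv> dim (span (v ` {..<m}))"
  obtains g :: "nat \<Rightarrow> nat" and a where "k \<le> m" "\<And>i. i < m - k \<Longrightarrow> g i < m"
    "\<And>i i'. i < m - k \<Longrightarrow> i' < m - k \<Longrightarrow> a i (g i') = (if i = i' then 1 else 0)"
    "\<And>i. i < m - k \<Longrightarrow> (\<Sum>s<m. scale (a i s) (v s)) = 0"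
    "\<And>d s. (\<Sum>s<m. scale (d s) (v s)) = 0 \<Longrightarrow> s < m \<Longrightarrow> d s = (\<Sum>i<m - k. d (g i) * a i s)"
proof -
  obtain B0 where B0: "B0 \<subseteq> v ` {..<m}" "independent B0" "v ` {..<m} \<subseteq> span B0" "card B0 = dim (v ` {..<m})"
    using basis_exists by blast
  then obtain B where B: "B \<subseteq> {..<m}" "inj_on v B" "B0 = v ` B"
    unfolding subset_image_inj by blast
  have finB: "finite B"
    using B(1) finite_subset by blast
  have kB: "k = card B"
    using B0(4) B by (simp add: k_def card_image)
  have indep: "c b = 0" if "(\<Sum>b\<in>B. scale (c b) (v b)) = 0" "b \<in> B" for c b
    using independent_family[OF finB B(2) _ that] B0(2) B(3) by simp
  define J where "J = {..<m} - B"
  have "card J = m - k"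
    using B(1) finB by (simp add: J_def card_Diff_subset kB)
  then obtain g where g: "bij_betw g {..<m - k} J"
    using ex_bij_betw_nat_finite[of J] by (auto simp: J_def lessThan_atLeast0)
  have gJ: "g i < m" "g i \<notin> B" if "i < m - k" for i
    using bij_betwE[OF g] that by (auto simp: J_def)
  have "\<exists>r. v j = (\<Sum>b\<in>B. scale (r b) (v b))" if "j < m" for j
    using B0(3) that B(3) span_family[OF finB, of "v j" v] by auto
  then obtain r where r: "\<And>j. j < m \<Longrightarrow> v j = (\<Sum>b\<in>B. scale (r j b) (v b))"
    by metis
  \<comment> \<open>Row \<open>i\<close> is the relation saying that \<open>v (g i)\<close> equals
    its expansion in the basis indexed by \<open>B\<close>.\<close>
  define a where "a i s = (if s \<in> B then - r (g i) s else if s = g i then 1 else 0)" for i s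
  have split: "(\<Sum>s<m. scale (d s) (v s)) = (\<Sum>s\<in>B. scale (d s) (v s)) + (\<Sum>s\<in>J. scale (d s) (v s))" for d
    using B(1) finB unfolding J_def by (subst add.commute) (rule sum.subset_diff, auto)
  have rel: "(\<Sum>s<m. scale (a i s) (v s)) = 0" if i: "i < m - k" for i
  proof -
    have "(\<Sum>s\<in>J. scale (a i s) (v s)) = (\<Sum>s\<in>J. if s = g i then v s else 0)"
      by (intro sum.cong) (auto simp: a_def J_def)
    also have "\<dots> = v (g i)"
      using gJ[OF i] by (simp add: J_def)
    finally show ?thesis
      using r[OF gJ(1)[OF i]] by (simp add: split a_def sum_negf)
  qed
  have a_g: "a i (g i') = (if i = i' then 1 else 0)" if "i < m - k" "i' < m - k" for i i'
    using that gJ bij_betw_imp_inj_on[OF g] by (auto simp: a_def inj_on_def)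
  have "d s = (\<Sum>i<m - k. d (g i) * a i s)"
    if d: "(\<Sum>s<m. scale (d s) (v s)) = 0" and s: "s < m" for d s
  proof -
    \<comment> \<open>Subtracting the rows weighted by the pivot entries of \<open>d\<close> leaves
      a relation supported on \<open>B\<close>, which is trivial.\<close>
    define c where "c s = d s - (\<Sum>i<m - k. d (g i) * a i s)" for s
    have "(\<Sum>s<m. scale (\<Sum>i<m - k. d (g i) * a i s) (v s))
        = (\<Sum>i<m - k. scale (d (g i)) (\<Sum>s<m. scale (a i s) (v s)))"
      by (simp add: scale_sum_left scale_sum_right sum.swap[of _ "{..<m}"])
    then have "(\<Sum>s<m. scale (c s) (v s)) = 0"
      using d rel by (simp add: c_def scale_left_diff_distrib sum_subtractf)
    moreover have cJ: "c s = 0" if "s \<in> J" for s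
    proof -
      obtain i' where i': "i' < m - k" "s = g i'"
        using g \<open>s \<in> J\<close> by (auto simp: bij_betw_def)
      then show ?thesis
        by (simp add: c_def a_g if_distrib[of "(*) _"] cong: if_cong)
    qed
    ultimately have "(\<Sum>s\<in>B. scale (c s) (v s)) = 0"
      by (simp add: split)
    then have "c s = 0"
      using indep[of c s] cJ[of s] s by (auto simp: J_def)
    then show ?thesis
      by (simp add: c_def)
  qed
  moreover have "k \<le> m"
    using card_mono[OF _ B(1)] kB by simp
  ultimately show thesis
    using that gJ(1) a_g rel by blast
qed

end

section \<open>Subalgebras given by matrices in echelon form\<close>

context lie_algebra
begin

lemma bracket_zero_left: "bracket 0 y = 0"
  using bracket_scale_left[of 0 0 y] by simp

lemma bracket_zero_right: "bracket x 0 = 0"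
  using bracket_scale_right[of x 0 0] by simp

lemma bracket_sum_left: "bracket (sum f I) y = (\<Sum>i\<in>I. bracket (f i) y)"
  by (induction I rule: infinite_finite_induct) (auto simp: bracket_zero_left bracket_add_left)

lemma bracket_sum_right: "bracket x (sum f I) = (\<Sum>i\<in>I. bracket x (f i))"
  by (induction I rule: infinite_finite_induct) (auto simp: bracket_zero_right bracket_add_right)

lemma subalgebra_span:
  assumes "\<And>x y. x \<in> S \<Longrightarrow> y \<in> S \<Longrightarrow> bracket x y \<in> span S"
  shows "subalgebra (span S)"
  unfolding subalgebra_def
proof (intro conjI ballI subspace_span)
  fix x y
  assume x: "x \<in> span S" and y: "y \<in> span S"
  have right: "bracket u y \<in> span S" if u: "u \<in> S" for u
    using y
  proof (induction rule: span_induct)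
    show "subspace {y. bracket u y \<in> span S}"
      by (auto simp: subspace_def bracket_zero_right bracket_add_right bracket_scale_right
          intro: span_zero span_add span_scale)
  qed (use assms u in auto)
  show "bracket x y \<in> span S"
    using x
  proof (induction rule: span_induct)
    show "subspace {x. bracket x y \<in> span S}"
      by (auto simp: subspace_def bracket_zero_left bracket_add_left bracket_scale_left
          intro: span_zero span_add span_scale)
  qed (use right in auto)
qed

lemma sum_row_elements:
  "(\<Sum>i<n. scale (d i) (row_element ls A i))
     = (\<Sum>s<length ls. scale (\<Sum>i<n. d i * A $$ (i, s)) (ls ! s))"
  by (simp add: row_element_def scale_sum_left scale_sum_right sum.swap[of _ "{..<length ls}"])

text \<open>For structure constants \<open>\<gamma>\<close>, the coordinates of the bracket are
  polynomials in the entries of \<open>A\<close>; this is what makes closure under the bracket a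
  polynomial condition.\<close>

lemma bracket_row_elements:
  assumes "\<And>p q. p < length ls \<Longrightarrow> q < length ls \<Longrightarrow>
    bracket (ls ! p) (ls ! q) = (\<Sum>s<length ls. scale (\<gamma> p q s) (ls ! s))"
  shows "bracket (row_element ls A i) (row_element ls A i')
    = (\<Sum>s<length ls. scale (\<Sum>p<length ls. \<Sum>q<length ls. A $$ (i, p) * A $$ (i', q) * \<gamma> p q s) (ls ! s))"
proof -
  let ?m = "length ls"
  have "bracket (row_element ls A i) (row_element ls A i')
    = (\<Sum>p<?m. \<Sum>q<?m. scale (A $$ (i, p) * A $$ (i', q)) (bracket (ls ! p) (ls ! q)))"
    by (simp add: row_element_def bracket_sum_left bracket_sum_right bracket_scale_left
        bracket_scale_right scale_sum_right mult.commute) (rule sum.swap)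
  also have "\<dots> = (\<Sum>p<?m. \<Sum>q<?m. \<Sum>s<?m. scale (A $$ (i, p) * A $$ (i', q) * \<gamma> p q s) (ls ! s))"
    by (intro sum.cong refl) (simp add: assms scale_sum_right)
  also have "\<dots> = (\<Sum>p<?m. \<Sum>s<?m. \<Sum>q<?m. scale (A $$ (i, p) * A $$ (i', q) * \<gamma> p q s) (ls ! s))"
    by (intro sum.cong refl sum.swap)
  also have "\<dots> = (\<Sum>s<?m. \<Sum>p<?m. \<Sum>q<?m. scale (A $$ (i, p) * A $$ (i', q) * \<gamma> p q s) (ls ! s))"
    by (rule sum.swap)
  finally show ?thesis
    by (simp add: scale_sum_left)
qed

lemma ordered_basis_coordinates:
  assumes "ordered_basis ls"
  obtains c where "x = (\<Sum>s<length ls. scale (c s) (ls ! s))"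
proof -
  have "(!) ls ` {..<length ls} = set ls"
    by (auto simp: set_conv_nth)
  then have "x \<in> span ((!) ls ` {..<length ls})"
    using assms by (simp add: ordered_basis_def)
  then show thesis
    using that by (auto simp: span_family)
qed

lemma ordered_basis_unique:
  assumes "ordered_basis ls"
    and "(\<Sum>j<length ls. scale (c j) (ls ! j)) = (\<Sum>j<length ls. scale (d j) (ls ! j))"
    and "j < length ls"
  shows "c j = d j"
  using assms unfolding ordered_basis_def by (intro basis_coordinates_unique) auto

lemma dim_ordered_basis: "ordered_basis ls \<Longrightarrow> dim UNIV = length ls"
  unfolding ordered_basis_def by (metis dim_span_eq_card_independent distinct_card)

section \<open>Matrices with an identity block in the pivot columns\<close>

context
  fixes ls :: "'l list" and A :: "'k mat" and n :: nat and g :: "nat \<Rightarrow> nat"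
  assumes ls: "ordered_basis ls"
    and A: "A \<in> carrier_mat n (length ls)"
    and pivot: "\<And>i. i < n \<Longrightarrow> g i < length ls"
    and echelon: "\<And>i i'. i < n \<Longrightarrow> i' < n \<Longrightarrow> A $$ (i, g i') = (if i = i' then 1 else 0)"
begin

text \<open>Only row \<open>i\<close> contributes to column \<open>g i\<close>, so the pivot
  coordinates are the coefficients themselves.\<close>

lemma echelon_coefficients:
  assumes "(\<Sum>s<length ls. scale (c s) (ls ! s)) = (\<Sum>i<n. scale (d i) (row_element ls A i))"
    and "i < n"
  shows "c (g i) = d i"
proof -
  have "c (g i) = (\<Sum>i'<n. d i' * A $$ (i', g i))"
    using assms(1) pivot[OF assms(2)] unfolding sum_row_elements
    by (rule ordered_basis_unique[OF ls])
  also have "\<dots> = (\<Sum>i'<n. if i' = i then d i' else 0)"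
    using assms(2) by (intro sum.cong) (auto simp: echelon)
  finally show ?thesis
    using assms(2) by simp
qed

lemma echelon_rows_independent:
  "(\<Sum>i<n. scale (d i) (row_element ls A i)) = 0 \<Longrightarrow> i < n \<Longrightarrow> d i = 0"
  using echelon_coefficients[of "\<lambda>_. 0" d i] by simp

lemma dim_echelon: "dim (associated_subspace ls A) = n"
  using dim_span_family[of "{..<n}" "row_element ls A"] echelon_rows_independent A
  by (simp add: associated_subspace_def)

text \<open>The coefficients are read off at the pivots, so membership yields equations polynomial
  in the entries of \<open>A\<close>, with no existential quantifier.\<close>

lemma echelon_coordinates:
  assumes "(\<Sum>s<length ls. scale (c s) (ls ! s)) \<in> associated_subspace ls A" "s < length ls"
  shows "c s = (\<Sum>i<n. c (g i) * A $$ (i, s))"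
proof -
  obtain d where d: "(\<Sum>s<length ls. scale (c s) (ls ! s)) = (\<Sum>i<n. scale (d i) (row_element ls A i))"
    using assms(1) A by (auto simp: associated_subspace_def span_family)
  then have "c s = (\<Sum>i<n. d i * A $$ (i, s))"
    using assms(2) unfolding sum_row_elements by (rule ordered_basis_unique[OF ls])
  then show ?thesis
    using echelon_coefficients[OF d] by simp
qed

lemma echelon_subalgebra:
  assumes \<gamma>: "\<And>p q. p < length ls \<Longrightarrow> q < length ls \<Longrightarrow>
      bracket (ls ! p) (ls ! q) = (\<Sum>s<length ls. scale (\<gamma> p q s) (ls ! s))"
    and D_def: "\<And>i i' s. D i i' s = (\<Sum>p<length ls. \<Sum>q<length ls. A $$ (i, p) * A $$ (i', q) * \<gamma> p q s)"
    and closed: "\<And>i i' s. i < n \<Longrightarrow> i' < n \<Longrightarrow> s < length ls \<Longrightarrow>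
      D i i' s = (\<Sum>t<n. D i i' (g t) * A $$ (t, s))"
  shows "subalgebra (associated_subspace ls A)"
  unfolding associated_subspace_def
proof (rule subalgebra_span)
  fix x y
  assume "x \<in> row_element ls A ` {..<dim_row A}" "y \<in> row_element ls A ` {..<dim_row A}"
  then obtain i i' where i: "i < n" "i' < n" "x = row_element ls A i" "y = row_element ls A i'"
    using A by auto
  have "bracket x y = (\<Sum>s<length ls. scale (D i i' s) (ls ! s))"
    unfolding i(3,4) D_def by (rule bracket_row_elements[OF \<gamma>])
  also have "\<dots> = (\<Sum>s<length ls. scale (\<Sum>t<n. D i i' (g t) * A $$ (t, s)) (ls ! s))"
    by (intro sum.cong refl arg_cong2[where f = scale] closed) (use i in auto)
  also have "\<dots> = (\<Sum>t<n. scale (D i i' (g t)) (row_element ls A t))"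
    by (rule sum_row_elements[symmetric])
  finally show "bracket x y \<in> span (row_element ls A ` {..<dim_row A})"
    using A by (auto simp: span_family)
qed

end

end

section \<open>The generic subalgebra\<close>

lemma sum_fun_apply: "(sum f I) x = (\<Sum>i\<in>I. f i x)"
  by (induction I rule: infinite_finite_induct) auto

context
  fixes scale_L :: "'k::alg_closed_field \<Rightarrow> 'l::ab_group_add \<Rightarrow> 'l"
    and bracket :: "'l \<Rightarrow> 'l \<Rightarrow> 'l"
    and scale_R :: "'k \<Rightarrow> 'r::field \<Rightarrow> 'r"
    and \<phi> :: "'l \<Rightarrow> 'r \<Rightarrow> 'r"
  assumes R: "field_algebra scale_R"
    and L: "lie_algebra scale_L bracket"
    and hom: "lie_hom_to_derivations scale_L bracket scale_R \<phi>"
    and inj: "inj \<phi>"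
begin

interpretation R: field_algebra scale_R by (rule R)
interpretation L: lie_algebra scale_L bracket by (rule L)
interpretation F: vector_space "fun_scale :: 'r \<Rightarrow> _" by (rule vector_space_fun_scale)

text \<open>\<open>scale_R c 1\<close> is the image of the scalar \<open>c\<close> in the field
  \<open>'r\<close>, so linearity over the base field becomes a statement about coefficients in
  \<open>'r\<close>.\<close>

lemma lie_hom_sum:
  "\<phi> (\<Sum>j\<in>I. scale_L (c j) (x j)) = (\<Sum>j\<in>I. fun_scale (scale_R (c j) 1) (\<phi> (x j)))"
proof -
  have add: "\<phi> (x + y) = \<phi> x + \<phi> y" and scale: "\<phi> (scale_L a x) = fun_scale (scale_R a 1) (\<phi> x)" for x y a
    using hom R.scale_mult_left[of a 1]
    by (auto simp: lie_hom_to_derivations_def Vector_Spaces.linear_iff fun_scale_def)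
  have "\<phi> 0 = 0"
    using add[of 0 0] by simp
  then show ?thesis
    by (induction I rule: infinite_finite_induct) (auto simp: add scale)
qed

lemma lie_hom_bracket: "\<phi> (bracket x y) t = \<phi> x (\<phi> y t) - \<phi> y (\<phi> x t)"
  using hom by (simp add: lie_hom_to_derivations_def commutator_def)

text \<open>Evaluating the relation \<open>\<alpha>\<close> at \<open>\<phi> l\<^sub>q t\<close> and the relation \<open>\<beta>\<close> at \<open>\<phi> l\<^sub>p t\<close> kills the
  two halves of the commutators separately.\<close>

lemma relation_bracket:
  fixes ls :: "'l list"
  defines "m \<equiv> length ls"
  assumes \<gamma>: "\<And>p q. p < m \<Longrightarrow> q < m \<Longrightarrow>
      bracket (ls ! p) (ls ! q) = (\<Sum>s<m. scale_L (\<gamma> p q s) (ls ! s))"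
    and \<alpha>: "(\<Sum>s<m. fun_scale (\<alpha> s) (\<phi> (ls ! s))) = 0"
    and \<beta>: "(\<Sum>s<m. fun_scale (\<beta> s) (\<phi> (ls ! s))) = 0"
  shows "(\<Sum>s<m. fun_scale (\<Sum>p<m. \<Sum>q<m. \<alpha> p * \<beta> q * scale_R (\<gamma> p q s) 1) (\<phi> (ls ! s))) = 0"
proof
  fix t
  let ?v = "\<lambda>s. \<phi> (ls ! s)"
  have rel: "(\<Sum>s<m. \<alpha> s * ?v s u) = 0" "(\<Sum>s<m. \<beta> s * ?v s u) = 0" for u
    using fun_cong[OF \<alpha>, of u] fun_cong[OF \<beta>, of u] by (simp_all add: sum_fun_apply fun_scale_def)
  have comm: "(\<Sum>s<m. scale_R (\<gamma> p q s) 1 * ?v s t) = ?v p (?v q t) - ?v q (?v p t)"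
    if "p < m" "q < m" for p q
    using lie_hom_bracket[of "ls ! p" "ls ! q" t] \<gamma>[OF that]
    by (simp add: lie_hom_sum sum_fun_apply fun_scale_def)
  have "(\<Sum>s<m. (\<Sum>p<m. \<Sum>q<m. \<alpha> p * \<beta> q * scale_R (\<gamma> p q s) 1) * ?v s t)
      = (\<Sum>s<m. \<Sum>p<m. \<Sum>q<m. \<alpha> p * \<beta> q * (scale_R (\<gamma> p q s) 1 * ?v s t))"
    by (simp add: sum_distrib_right mult.assoc)
  also have "\<dots> = (\<Sum>p<m. \<Sum>s<m. \<Sum>q<m. \<alpha> p * \<beta> q * (scale_R (\<gamma> p q s) 1 * ?v s t))"
    by (rule sum.swap)
  also have "\<dots> = (\<Sum>p<m. \<Sum>q<m. \<Sum>s<m. \<alpha> p * \<beta> q * (scale_R (\<gamma> p q s) 1 * ?v s t))"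
    by (intro sum.cong refl sum.swap)
  also have "\<dots> = (\<Sum>p<m. \<Sum>q<m. \<alpha> p * \<beta> q * (?v p (?v q t) - ?v q (?v p t)))"
    by (intro sum.cong refl) (simp add: comm flip: sum_distrib_left)
  also have "\<dots> = (\<Sum>p<m. \<Sum>q<m. \<beta> q * (\<alpha> p * ?v p (?v q t))) - (\<Sum>p<m. \<Sum>q<m. \<alpha> p * (\<beta> q * ?v q (?v p t)))"
    by (simp add: sum_subtractf algebra_simps)
  \<comment> \<open>After the exchange both inner sums are instances of \<open>rel\<close>.\<close>
  also have "(\<Sum>p<m. \<Sum>q<m. \<beta> q * (\<alpha> p * ?v p (?v q t))) = (\<Sum>q<m. \<Sum>p<m. \<beta> q * (\<alpha> p * ?v p (?v q t)))"
    by (rule sum.swap)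
  also have "\<dots> - (\<Sum>p<m. \<Sum>q<m. \<alpha> p * (\<beta> q * ?v q (?v p t))) = 0"
    by (simp add: rel flip: sum_distrib_left)
  finally show "(\<Sum>s<m. fun_scale (\<Sum>p<m. \<Sum>q<m. \<alpha> p * \<beta> q * scale_R (\<gamma> p q s) 1) (?v s)) t = 0 t"
    by (simp add: sum_fun_apply fun_scale_def)
qed

text \<open>This is stronger than (ii): \<open>V\<close> misses the degenerate locus entirely, so
  every point of \<open>V\<close> gives a subalgebra of codimension \<open>k\<close>, which also
  serves (i).\<close>

lemma generic_subalgebra:
  assumes ls: "L.ordered_basis ls"
  defines "k \<equiv> F.dim (F.span (range \<phi>))"
  obtains V where "k \<le> length ls" "irreducible_variety (length ls - k) (length ls) V"
    "V \<subseteq> L.subalgebra_variety ls k" "V \<inter> L.degenerate_locus ls k = {}"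
    "\<forall>A\<in>V. L.dim (L.associated_subspace ls A) = length ls - k"
    "(\<Inter>A\<in>V. L.associated_subspace ls A) = {0}"
proof -
  define m where "m = length ls"
  define v where "v s = \<phi> (ls ! s)" for s
  define n where "n = m - k"
  define e where "e c = scale_R c 1" for c
  have "F.span (range \<phi>) = F.span (v ` {..<m})"
  proof (rule F.span_eq[THEN iffD2], intro conjI subsetI)
    fix y assume "y \<in> range \<phi>"
    then obtain x where x: "y = \<phi> x"
      by auto
    obtain c where "x = (\<Sum>s<length ls. scale_L (c s) (ls ! s))"
      using L.ordered_basis_coordinates[OF ls] .
    then have "y = (\<Sum>s<m. fun_scale (e (c s)) (v s))"
      unfolding x by (simp add: lie_hom_sum m_def v_def e_def)
    then show "y \<in> F.span (v ` {..<m})"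
      by (auto simp: F.span_family)
  next
    fix y assume "y \<in> v ` {..<m}"
    then show "y \<in> F.span (range \<phi>)"
      by (auto simp: v_def intro: F.span_base)
  qed
  then have k: "k = F.dim (F.span (v ` {..<m}))"
    by (simp add: k_def)
  \<comment> \<open>The rows of \<open>a\<close> form the echelon basis of the relations among the
    \<open>v s\<close>; this is the generic point.\<close>
  obtain g a where "k \<le> m" and g: "\<And>i. i < n \<Longrightarrow> g i < m"
    and a_pivot: "\<And>i i'. i < n \<Longrightarrow> i' < n \<Longrightarrow> a i (g i') = (if i = i' then 1 else 0)"
    and a_rel: "\<And>i. i < n \<Longrightarrow> (\<Sum>s<m. fun_scale (a i s) (v s)) = 0"
    and a_basis: "\<And>d s. (\<Sum>s<m. fun_scale (d s) (v s)) = 0 \<Longrightarrow> s < m \<Longrightarrow> d s = (\<Sum>i<n. d (g i) * a i s)"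
    using F.relations_echelon_basis[of v m, folded k n_def] by blast
  have "\<forall>p q. \<exists>c. bracket (ls ! p) (ls ! q) = (\<Sum>s<m. scale_L (c s) (ls ! s))"
    using L.ordered_basis_coordinates[OF ls] unfolding m_def by metis
  then obtain \<gamma> where \<gamma>: "\<And>p q. bracket (ls ! p) (ls ! q) = (\<Sum>s<m. scale_L (\<gamma> p q s) (ls ! s))"
    by metis
  have e: "e 1 = 1" "\<And>c d. e (c + d) = e c + e d" "\<And>c d. e (c * d) = e c * e d"
    using R.scale_mult_left by (auto simp: e_def R.scale_left_distrib)
  have e0: "e 0 = 0" and em1: "e (- 1) = - 1"
    by (auto simp: e_def)
  define V where "V = closure_of_point e n m a"
  note const = value_at.const[of e n m a]
  note entry = value_at.entry[of _ n _ m e a]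
  note vanishing = vanishing_on_closure[OF e, of n m a]
  \<comment> \<open>Transfer to \<open>V\<close>: polynomials with equal values at the generic point
    agree at every point of \<open>V\<close>.\<close>
  have on_V: "p A = q A" if "A \<in> V" "value_at e n m a p r" "value_at e n m a q r" for A p q r
    using value_at_diff[OF em1 that(2,3)] that(1) by (auto simp: V_def closure_of_point_def)
  have V_carrier: "A \<in> carrier_mat n (length ls)" if "A \<in> V" for A
    using that by (auto simp: V_def closure_of_point_def m_def)
  have g': "g i < length ls" if "i < n" for i
    using g[OF that] by (simp add: m_def)
  have echelon: "A $$ (i, g i') = (if i = i' then 1 else 0)" if "A \<in> V" "i < n" "i' < n" for A i i'
  proof (rule on_V[OF that(1) entry[OF that(2) g[OF that(3)]]])
    show "value_at e n m a (\<lambda>A. if i = i' then 1 else 0) (a i (g i'))"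
      using const[of "if i = i' then 1 else 0"] a_pivot[OF that(2,3)] e(1) e0
      by (cases "i = i'") simp_all
  qed
  \<comment> \<open>\<open>D\<close> and \<open>DR\<close> are the coordinates of the bracket of two
    rows, at a point \<open>A\<close> and at the generic point.\<close>
  define D where "D A i i' s = (\<Sum>p<m. \<Sum>q<m. A $$ (i, p) * A $$ (i', q) * \<gamma> p q s)" for A i i' s
  define DR where "DR i i' s = (\<Sum>p<m. \<Sum>q<m. a i p * a i' q * e (\<gamma> p q s))" for i i' s
  have D_value: "value_at e n m a (\<lambda>A. D A i i' s) (DR i i' s)" if "i < n" "i' < n" for i i' s
    unfolding D_def DR_def using that
    by (intro value_at_sum e0 finite_lessThan value_at.mult const entry) auto
  have D_closed: "D A i i' s = (\<Sum>t<n. D A i i' (g t) * A $$ (t, s))"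
    if "A \<in> V" "i < n" "i' < n" "s < m" for A i i' s
  proof (rule on_V[OF that(1) D_value[OF that(2,3)]])
    \<comment> \<open>The bracket of two relations is a relation, so it expands in the rows of
      \<open>a\<close> with its pivot entries as coefficients.\<close>
    have "(\<Sum>s<m. fun_scale (DR i i' s) (v s)) = 0"
      using relation_bracket[of ls \<gamma> "a i" "a i'"] \<gamma> a_rel that unfolding DR_def e_def v_def m_def by blast
    then have "DR i i' s = (\<Sum>t<n. DR i i' (g t) * a t s)"
      using that by (intro a_basis)
    then show "value_at e n m a (\<lambda>A. \<Sum>t<n. D A i i' (g t) * A $$ (t, s)) (DR i i' s)"
      using that by (auto intro!: value_at_sum e0 value_at.mult D_value entry)
  qed
  have irred: "irreducible_variety n m V"
    unfolding V_def by (rule irreducible_closure_of_point[OF e])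
  have sub: "L.subalgebra (L.associated_subspace ls A)" if A: "A \<in> V" for A
    by (rule L.echelon_subalgebra[OF ls V_carrier[OF A] g' echelon[OF A], where \<gamma> = \<gamma> and D = "D A"])
      (use \<gamma> D_closed[OF A] in \<open>auto simp: m_def D_def\<close>)
  have indep: "\<not> (\<exists>i<n. c i \<noteq> 0)" if A: "A \<in> V" "(\<Sum>i<n. scale_L (c i) (L.row_element ls A i)) = 0" for A c
    using L.echelon_rows_independent[OF ls V_carrier[OF A(1)] g' echelon[OF A(1)] A(2)] by blast
  have inter: "x = 0" if x: "\<And>A. A \<in> V \<Longrightarrow> x \<in> L.associated_subspace ls A" for x
  proof -
    obtain c where c: "x = (\<Sum>s<length ls. scale_L (c s) (ls ! s))"
      using L.ordered_basis_coordinates[OF ls] .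
    \<comment> \<open>The membership equations of \<open>x\<close> hold on all of \<open>V\<close>,
      so by the Nullstellensatz they hold at the generic point. Hence the coordinates of
      \<open>x\<close> are a combination of relations, and \<open>\<phi> x = 0\<close>.\<close>
    have coords: "e (c s) = (\<Sum>i<n. e (c (g i)) * a i s)" if s: "s < m" for s
    proof -
      have "c s = (\<Sum>i<n. c (g i) * A $$ (i, s))" if A: "A \<in> V" for A
        using L.echelon_coordinates[OF ls V_carrier[OF A] g' echelon[OF A], of c s] x[OF A] s
        by (simp add: c m_def)
      moreover have "value_at e n m a (\<lambda>A. c s - (\<Sum>i<n. c (g i) * A $$ (i, s)))
          (e (c s) - (\<Sum>i<n. e (c (g i)) * a i s))"
        using s by (intro value_at_diff em1 const value_at_sum e0 value_at.mult entry) auto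
      ultimately have "e (c s) - (\<Sum>i<n. e (c (g i)) * a i s) = 0"
        using vanishing unfolding V_def by force
      then show ?thesis
        by simp
    qed
    have "\<phi> x = (\<Sum>s<m. fun_scale (\<Sum>i<n. e (c (g i)) * a i s) (v s))"
      unfolding c by (simp add: lie_hom_sum m_def[symmetric] v_def coords flip: e_def)
    also have "\<dots> = (\<Sum>i<n. fun_scale (e (c (g i))) (\<Sum>s<m. fun_scale (a i s) (v s)))"
      by (simp add: F.scale_sum_left F.scale_sum_right sum.swap[of _ "{..<m}"])
    also have "\<dots> = \<phi> 0"
      using a_rel lie_hom_sum[of _ _ "{}"] by simp
    finally show "x = 0"
      using inj by (simp add: inj_eq)
  qed
  show thesis
  proof (rule that[of V])
    show "V \<subseteq> L.subalgebra_variety ls k"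
      using sub V_carrier by (auto simp: L.subalgebra_variety_def n_def m_def)
    show "V \<inter> L.degenerate_locus ls k = {}"
      using indep by (auto simp: L.degenerate_locus_def n_def m_def)
    show "(\<Inter>A\<in>V. L.associated_subspace ls A) = {0}"
      using inter by (auto simp: L.associated_subspace_def intro: L.span_zero)
    show "\<forall>A\<in>V. L.dim (L.associated_subspace ls A) = length ls - k"
      using L.dim_echelon[OF ls V_carrier g' echelon] by (simp add: n_def m_def)
  qed (use \<open>k \<le> m\<close> irred in \<open>auto simp: n_def m_def\<close>)
qed

end

theorem proposition2:
  fixes scale_L :: "'k::alg_closed_field \<Rightarrow> 'l::ab_group_add \<Rightarrow> 'l"
    and bracket :: "'l \<Rightarrow> 'l \<Rightarrow> 'l"
    and scale_R :: "'k \<Rightarrow> 'r::field \<Rightarrow> 'r"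
    and \<phi> :: "'l \<Rightarrow> 'r \<Rightarrow> 'r"
    and k :: nat
  assumes "field_algebra scale_R"
    and "finite_dimensional_lie_algebra scale_L bracket"
    and "lie_hom_to_derivations scale_L bracket scale_R \<phi>"
    and "inj \<phi>"
    and "k = vector_space.dim fun_scale (module.span fun_scale (range \<phi>))"
  shows "(\<exists>S. lie_algebra.subalgebra scale_L bracket S \<and>
            vector_space.dim scale_L S + k = vector_space.dim scale_L UNIV) \<and>
         (\<forall>ls. lie_algebra.ordered_basis scale_L ls \<longrightarrow>
            (\<exists>V. irreducible_variety (length ls - k) (length ls) V \<and>
                 V \<subseteq> lie_algebra.subalgebra_variety scale_L bracket ls k \<and>
                 \<not> V \<subseteq> lie_algebra.degenerate_locus scale_L bracket ls k \<and>
                 (\<Inter>A\<in>V. lie_algebra.associated_subspace scale_L ls A) = {0}))"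
proof -
  interpret L: finite_dimensional_lie_algebra scale_L bracket by (rule assms(2))
  note generic = generic_subalgebra[OF assms(1) L.lie_algebra_axioms assms(3,4), folded assms(5)]
  obtain B where B: "finite B" "L.span B = UNIV"
    using L.finite_dimensional by blast
  obtain B' where B': "B' \<subseteq> B" "L.independent B'" "B \<subseteq> L.span B'"
    using L.maximal_independent_subset by blast
  then have "L.span B' = UNIV"
    using B(2) L.span_mono[OF B'(3)] by (auto simp: L.span_span)
  moreover obtain ls0 where "distinct ls0" "set ls0 = B'"
    using finite_distinct_list[OF finite_subset[OF B'(1) B(1)]] by blast
  ultimately have ls0: "L.ordered_basis ls0"
    using B'(2) by (simp add: L.ordered_basis_def)
  have "\<exists>S. L.subalgebra S \<and> L.dim S + k = L.dim UNIV"
  proof -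
    obtain V where V: "k \<le> length ls0" "irreducible_variety (length ls0 - k) (length ls0) V"
      "V \<subseteq> L.subalgebra_variety ls0 k" "V \<inter> L.degenerate_locus ls0 k = {}"
      "\<forall>A\<in>V. L.dim (L.associated_subspace ls0 A) = length ls0 - k"
      "(\<Inter>A\<in>V. L.associated_subspace ls0 A) = {0}"
      using generic[OF ls0] .
    \<comment> \<open>Irreducible varieties are nonempty by definition, and any point of
      \<open>V\<close> will do.\<close>
    then obtain A where A: "A \<in> V"
      by (auto simp: irreducible_variety_def)
    then have "L.subalgebra (L.associated_subspace ls0 A)"
      using V(3) by (auto simp: L.subalgebra_variety_def)
    then show ?thesis
      \<comment> \<open>Here \<open>k \<le> length ls0\<close> ensures that the subtraction of
        naturals is not truncated.\<close>
      using V(1,5) A L.dim_ordered_basis[OF ls0] by auto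
  qed
  moreover have "\<exists>V. irreducible_variety (length ls - k) (length ls) V \<and>
      V \<subseteq> L.subalgebra_variety ls k \<and> \<not> V \<subseteq> L.degenerate_locus ls k \<and>
      (\<Inter>A\<in>V. L.associated_subspace ls A) = {0}" if ls: "L.ordered_basis ls" for ls
  proof -
    obtain V where V: "k \<le> length ls" "irreducible_variety (length ls - k) (length ls) V"
      "V \<subseteq> L.subalgebra_variety ls k" "V \<inter> L.degenerate_locus ls k = {}"
      "\<forall>A\<in>V. L.dim (L.associated_subspace ls A) = length ls - k"
      "(\<Inter>A\<in>V. L.associated_subspace ls A) = {0}"
      using generic[OF ls] .
    then have "\<not> V \<subseteq> L.degenerate_locus ls k"
      by (auto simp: irreducible_variety_def)
    then show ?thesis
      using V(2,3,6) by blast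
  qed
  ultimately show ?thesis
    by blast
qed

end
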